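(* Let $G=(V,E)$ be a finite simple graph with $V\neq\emptyset$ and let $\mathcal{C}\subseteq V$ be an independent set of $G$. Then: 1. For any $x\in V\setminus\mathcal{C}$, the inequality $p_{x}\ge 0$ defines a facet of $\mathbf{M}(G,\mathcal{C})$. 2. If $x\in\mathcal{C}$, then the inequality $p_{x}\ge 0$ defines a facet of $\mathbf{M}(G,\mathcal{C})$ if and only if $x$ is isolated in $G$ (i.e. has no neighbors). 3. For any $x\in\mathcal{C}$ and $y\sim x$, the inequality $p_{x}\ge p_{y}$ defines a facet of $\mathbf{M}(G,\mathcal{C})$.
   Context: Graphs are simple (no loops, no multiple edges) and undirected; $x\sim y$ means $(x,y)\in E$. A set of nodes is independent if it contains no two adjacent nodes. $\Delta(V)=\{p\in\mathbb{R}^V : p_x\ge 0 \text{ for all } x\in V,\ \sum_{x\in V}p_x=1\}$ is the set of probability distributions on $V$. A point $x\in V$ is a mode of $p\in\Delta(V)$ if $p_x\ge p_y$ for all $y\sim x$. The polytope of $\mathcal{C}$-modes in $G$ is $\mathbf{M}(G,\mathcal{C})=\{p\in\Delta(V): \text{every } x\in\mathcal{C}\text{ is a mode of } p\}$. A valid inequality for a polytope $P$ defines a facet if the set of points of $P$ at which it holds with equality is a face of dimension $\dim P-1$ (with the usual convention $\dim\emptyset=-1$). *)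

theory Defs
  imports "HOL-Analysis.Analysis"
begin

text \<open>A finite simple graph is given by its adjacency relation on a finite vertex type
  \<^typ>\<open>'v::finite\<close>, so its vertex set is \<^term>\<open>UNIV :: 'v::finite set\<close>, which is finite and
  nonempty, and \<open>\<real>\<^sup>V\<close> is \<^typ>\<open>real ^ ('v::finite)\<close>.\<close>

definition simple_graph :: "('v \<Rightarrow> 'v \<Rightarrow> bool) \<Rightarrow> bool" where
  "simple_graph E \<longleftrightarrow> irreflp E \<and> symp E"

definition independent_nodes :: "('v \<Rightarrow> 'v \<Rightarrow> bool) \<Rightarrow> 'v set \<Rightarrow> bool" where
  "independent_nodes E C \<longleftrightarrow> (\<forall>x\<in>C. \<forall>y\<in>C. \<not> E x y)"

definition isolated_node :: "('v \<Rightarrow> 'v \<Rightarrow> bool) \<Rightarrow> 'v \<Rightarrow> bool" where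
  "isolated_node E x \<longleftrightarrow> (\<forall>y. \<not> E x y)"

definition prob_simplex :: "(real ^ 'v::finite) set" where
  "prob_simplex = {p. (\<forall>x. p $ x \<ge> 0) \<and> (\<Sum>x\<in>UNIV. p $ x) = 1}"

definition is_mode :: "('v \<Rightarrow> 'v \<Rightarrow> bool) \<Rightarrow> real ^ 'v::finite \<Rightarrow> 'v \<Rightarrow> bool" where
  "is_mode E p x \<longleftrightarrow> (\<forall>y. E y x \<longrightarrow> p $ x \<ge> p $ y)"

definition mode_polytope :: "('v \<Rightarrow> 'v \<Rightarrow> bool) \<Rightarrow> 'v set \<Rightarrow> (real ^ 'v::finite) set" where
  "mode_polytope E C = {p \<in> prob_simplex. \<forall>x\<in>C. is_mode E p x}"

text \<open>The inequality \<open>l p \<ge> r p\<close> is valid on \<open>P\<close> and defines a facet. The library's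
  \<open>(facet_of)\<close> is not used, because it excludes the empty face; here the empty face is a
  facet of a single point, as \<^term>\<open>aff_dim {} = -1\<close>.\<close>

definition defines_facet ::
  "'a::euclidean_space set \<Rightarrow> ('a \<Rightarrow> real) \<Rightarrow> ('a \<Rightarrow> real) \<Rightarrow> bool" where
  "defines_facet P l r \<longleftrightarrow>
     (\<forall>p\<in>P. l p \<ge> r p) \<and>
     {p \<in> P. l p = r p} face_of P \<and>
     aff_dim {p \<in> P. l p = r p} = aff_dim P - 1"

end

theory Submission imports Defs begin

text \<open>Since \<open>C\<close> is independent, a mode \<open>x \<in> C\<close> with a neighbor \<open>y \<notin> C\<close> satisfies
  \<open>p\<^sub>x \<ge> p\<^sub>y \<ge> 0\<close>, so the polytope is cut out of the hyperplane of total mass 1 by the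
  claimed facet inequalities alone. If \<open>V\<close> has at least two nodes, there is
  for each of them a point at which it is tight while all the others are strict; near that point its face fills
  a hyperplane section, which has codimension 1. When \<open>x \<in> C\<close> has a neighbor \<open>y\<close>, the
  face \<open>p\<^sub>x = 0\<close> lies properly inside the facet \<open>p\<^sub>x = p\<^sub>y\<close>, so it is too small.\<close>

section \<open>Dimension of sets cut from an affine set by halfspaces\<close>

text \<open>Finitely many strict inequalities define an open set, and a nonempty relatively open
  piece of \<open>S\<close> already spans \<open>S\<close>; \<open>T\<close> is squeezed between
  that piece and \<open>S\<close>.\<close>

lemma aff_dim_affine_Int_strict_halfspaces:
  fixes S :: "'a::euclidean_space set"
  assumes "affine S" "finite A" "q \<in> S" "\<forall>a\<in>A. a \<bullet> q > 0"
    and "S \<inter> {p. \<forall>a\<in>A. a \<bullet> p > 0} \<subseteq> T" "T \<subseteq> S"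
  shows "aff_dim T = aff_dim S"
proof -
  have "{p. \<forall>a\<in>A. a \<bullet> p > 0} = (\<Inter>a\<in>A. {p. a \<bullet> p > 0})"
    by auto
  with \<open>finite A\<close> have "open {p. \<forall>a\<in>A. a \<bullet> p > 0}"
    by (simp add: open_INT open_halfspace_gt)
  moreover have "S \<inter> {p. \<forall>a\<in>A. a \<bullet> p > 0} \<noteq> {}"
    using assms by auto
  ultimately have "aff_dim (S \<inter> {p. \<forall>a\<in>A. a \<bullet> p > 0}) = aff_dim S"
    using \<open>affine S\<close> by (simp add: aff_dim_convex_Int_open affine_imp_convex)
  then show ?thesis
    using aff_dim_subset[OF assms(5)] aff_dim_subset[OF assms(6)] by linarith
qed

text \<open>The previous lemma is used twice: with \<open>q0\<close> for \<open>P\<close> inside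
  \<open>S\<close>, and with \<open>q1\<close> for the tight set inside the section of
  \<open>S\<close> by the hyperplane of \<open>a\<close>.\<close>

lemma aff_dim_halfspaces_tight:
  fixes S :: "'a::euclidean_space set"
  assumes "affine S" "finite A" "q0 \<in> S" "\<forall>b\<in>A. b \<bullet> q0 > 0"
    and "a \<in> A" "q1 \<in> S" "a \<bullet> q1 = 0" "\<forall>b\<in>A - {a}. b \<bullet> q1 > 0"
  defines "P \<equiv> S \<inter> {p. \<forall>b\<in>A. b \<bullet> p \<ge> 0}"
  shows "aff_dim {p \<in> P. a \<bullet> p = 0} = aff_dim P - 1"
proof -
  have "aff_dim P = aff_dim S"
    by (rule aff_dim_affine_Int_strict_halfspaces[OF assms(1-4)]) (auto simp: P_def less_imp_le)
  moreover have "aff_dim {p \<in> P. a \<bullet> p = 0} = aff_dim (S \<inter> {p. a \<bullet> p = 0})"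
  proof (rule aff_dim_affine_Int_strict_halfspaces)
    show "affine (S \<inter> {p. a \<bullet> p = 0})"
      using \<open>affine S\<close> affine_hyperplane by blast
    show "S \<inter> {p. a \<bullet> p = 0} \<inter> {p. \<forall>b\<in>A - {a}. b \<bullet> p > 0} \<subseteq> {p \<in> P. a \<bullet> p = 0}"
      unfolding P_def by clarsimp (metis DiffI less_imp_le order_refl singletonD)
    show "\<forall>b\<in>A - {a}. b \<bullet> q1 > 0"
      by fact
  qed (use assms in auto)
  moreover have "aff_dim (S \<inter> {p. a \<bullet> p = 0}) = aff_dim S - 1"
  proof -
    \<comment> \<open>The hyperplane meets \<open>S\<close> at \<open>q1\<close> and misses
      \<open>q0\<close>, so the dimension drops by exactly one.\<close>
    have "q1 \<in> S \<inter> {p. a \<bullet> p = 0}" "\<not> S \<subseteq> {p. a \<bullet> p = 0}"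
      using assms(3-7) by force+
    then show ?thesis
      using aff_dim_affine_Int_hyperplane[OF \<open>affine S\<close>, of a 0] by auto
  qed
  ultimately show ?thesis
    by simp
qed

section \<open>The polytope as a system of homogeneous inequalities\<close>

definition unit_sum_hyperplane :: "(real ^ 'v::finite) set" where
  "unit_sum_hyperplane = {p. (\<Sum>x\<in>UNIV. p $ x) = 1}"

text \<open>Inner normals of the claimed facet inequalities. Nonnegativity at a non-isolated node of
  \<open>C\<close> is left out: no point could make it tight while all the others are
  strict.\<close>

definition mode_normals :: "('v \<Rightarrow> 'v \<Rightarrow> bool) \<Rightarrow> 'v set \<Rightarrow> (real ^ 'v::finite) set" where
  "mode_normals E C =
     {axis x 1 | x. x \<notin> C \<or> isolated_node E x} \<union> {axis x 1 - axis y 1 | x y. x \<in> C \<and> E y x}"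

lemma unit_sum_hyperplane_eq: "unit_sum_hyperplane = {p. vec 1 \<bullet> p = 1}"
  by (simp add: unit_sum_hyperplane_def inner_vec_def)

lemma affine_unit_sum_hyperplane: "affine unit_sum_hyperplane"
  by (simp add: unit_sum_hyperplane_eq affine_hyperplane)

lemma aff_dim_unit_sum_hyperplane:
  "aff_dim (unit_sum_hyperplane :: (real ^ 'v::finite) set) = int CARD('v) - 1"
proof -
  have "vec 1 \<noteq> (0 :: real ^ 'v)"
    by (simp add: vec_eq_iff)
  then show ?thesis
    by (simp add: unit_sum_hyperplane_eq)
qed

lemma finite_mode_normals: "finite (mode_normals E C)"
proof -
  have "mode_normals E C \<subseteq>
      range (\<lambda>x. axis x 1) \<union> range (\<lambda>(x, y). axis x 1 - axis y 1)"
    by (auto simp: mode_normals_def)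
  then show ?thesis
    by (rule finite_subset) simp
qed

lemma Ball_mode_normals:
  "(\<forall>a\<in>mode_normals E C. Q (a :: real ^ 'v::finite)) \<longleftrightarrow>
     (\<forall>x. x \<notin> C \<or> isolated_node E x \<longrightarrow> Q (axis x 1)) \<and>
     (\<forall>x\<in>C. \<forall>y. E y x \<longrightarrow> Q (axis x 1 - axis y 1))"
  by (auto simp: mode_normals_def)

lemma inner_axis_1: "axis x 1 \<bullet> p = (p :: real ^ 'v::finite) $ x"
  by (simp add: inner_axis')

lemma mode_polytope_eq:
  fixes E :: "'v::finite \<Rightarrow> 'v \<Rightarrow> bool"
  assumes "simple_graph E" "independent_nodes E C"
  shows "mode_polytope E C = unit_sum_hyperplane \<inter> {p. \<forall>a\<in>mode_normals E C. a \<bullet> p \<ge> 0}"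
proof -
  have "p $ x \<ge> 0"
    if nonneg: "\<And>x. x \<notin> C \<or> isolated_node E x \<Longrightarrow> p $ x \<ge> 0"
      and mode: "\<And>x y. x \<in> C \<Longrightarrow> E y x \<Longrightarrow> p $ y \<le> p $ x" for p :: "real ^ 'v" and x
  proof (cases "x \<notin> C \<or> isolated_node E x")
    case False
    then obtain y where "x \<in> C" "E y x" "y \<notin> C"
      using assms unfolding isolated_node_def independent_nodes_def simple_graph_def
      by (meson sympD)
    with nonneg mode show ?thesis
      by (meson order_trans)
  qed (use nonneg in blast)
  then show ?thesis
    by (auto simp: mode_polytope_def prob_simplex_def unit_sum_hyperplane_def is_mode_def
        Ball_mode_normals inner_axis_1 inner_diff_left)
qed

text \<open>All inequalities are homogeneous, so scaling to total mass 1 keeps their signs. Witness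
  points can thus be given by small integer weights.\<close>

lemma normalize_weights:
  fixes w :: "real ^ 'v::finite"
  assumes "(\<Sum>x\<in>UNIV. w $ x) > 0"
  obtains q c where "q \<in> unit_sum_hyperplane" "c > 0" "\<And>a. a \<bullet> q = c * (a \<bullet> w)"
proof
  let ?c = "inverse (\<Sum>x\<in>UNIV. w $ x)"
  show "?c *\<^sub>R w \<in> unit_sum_hyperplane"
    using assms by (simp add: unit_sum_hyperplane_def flip: sum_distrib_left)
  show "?c > 0"
    using assms by simp
  show "a \<bullet> (?c *\<^sub>R w) = ?c * (a \<bullet> w)" for a
    by simp
qed

lemma mode_polytope_interior_point:
  fixes E :: "'v::finite \<Rightarrow> 'v \<Rightarrow> bool"
  assumes "independent_nodes E C"
  obtains q where "q \<in> unit_sum_hyperplane" "\<forall>a\<in>mode_normals E C. a \<bullet> q > 0"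
proof -
  \<comment> \<open>By independence, every neighbor of a node of weight 2 has weight 1.\<close>
  define w :: "real ^ 'v" where "w = (\<chi> x. if x \<in> C then 2 else 1)"
  have "(\<Sum>x\<in>UNIV. w $ x) > 0"
    by (intro sum_pos) (auto simp: w_def)
  then obtain q c where "q \<in> unit_sum_hyperplane" "c > 0" "\<And>a. a \<bullet> q = c * (a \<bullet> w)"
    by (rule normalize_weights) blast
  moreover have "\<forall>a\<in>mode_normals E C. a \<bullet> w > 0"
    using assms unfolding Ball_mode_normals independent_nodes_def
    by (auto simp: inner_axis_1 inner_diff_left w_def)
  ultimately show ?thesis
    using that by simp
qed

section \<open>Dimensions of the claimed facets\<close>

lemma aff_dim_mode_polytope_tight:
  fixes E :: "'v::finite \<Rightarrow> 'v \<Rightarrow> bool"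
  assumes "simple_graph E" "independent_nodes E C" "a \<in> mode_normals E C"
    and "(\<Sum>x\<in>UNIV. w $ x) > 0" "a \<bullet> w = 0" "\<forall>b\<in>mode_normals E C. b \<noteq> a \<longrightarrow> b \<bullet> w > 0"
  shows "aff_dim {p \<in> mode_polytope E C. a \<bullet> p = 0} = aff_dim (mode_polytope E C) - 1"
proof -
  obtain q0 where q0: "q0 \<in> unit_sum_hyperplane" "\<forall>a\<in>mode_normals E C. a \<bullet> q0 > 0"
    using mode_polytope_interior_point[OF assms(2)] .
  obtain q c where q: "q \<in> unit_sum_hyperplane" "c > 0" "\<And>a. a \<bullet> q = c * (a \<bullet> w)"
    using normalize_weights[OF assms(4)] by blast
  have "a \<bullet> q = 0" "\<forall>b\<in>mode_normals E C - {a}. b \<bullet> q > 0"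
    using q(2,3) assms(5,6) by auto
  from aff_dim_halfspaces_tight[OF affine_unit_sum_hyperplane finite_mode_normals q0
      assms(3) q(1) this]
  show ?thesis
    by (simp add: mode_polytope_eq[OF assms(1,2)])
qed

lemma aff_dim_mode_polytope_zero:
  fixes E :: "'v::finite \<Rightarrow> 'v \<Rightarrow> bool"
  assumes "simple_graph E" "independent_nodes E C" "x \<notin> C \<or> isolated_node E x"
  shows "aff_dim {p \<in> mode_polytope E C. p $ x = 0} = aff_dim (mode_polytope E C) - 1"
proof (cases "\<exists>z. z \<noteq> x")
  case True
  then obtain z where "z \<noteq> x" ..
  \<comment> \<open>Weight 0 at \<open>x\<close> breaks no mode inequality: if \<open>x\<close> is
    outside \<open>C\<close>, lowering it only widens the gaps, and an isolated \<open>x\<close>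
    occurs in none. The node \<open>z\<close> keeps the total positive.\<close>
  define w :: "real ^ 'v" where "w = (\<chi> u. if u = x then 0 else if u \<in> C then 2 else 1)"
  have "aff_dim {p \<in> mode_polytope E C. axis x 1 \<bullet> p = 0} = aff_dim (mode_polytope E C) - 1"
  proof (rule aff_dim_mode_polytope_tight[OF assms(1,2)])
    show "axis x 1 \<in> mode_normals E C"
      using assms(3) by (auto simp: mode_normals_def)
    show "(\<Sum>u\<in>UNIV. w $ u) > 0"
      using \<open>z \<noteq> x\<close> by (intro sum_pos2[of _ z]) (auto simp: w_def)
    show "\<forall>b\<in>mode_normals E C. b \<noteq> axis x 1 \<longrightarrow> b \<bullet> w > 0"
      using assms unfolding Ball_mode_normals independent_nodes_def isolated_node_def
        simple_graph_def
      by (auto simp: inner_axis_1 inner_diff_left w_def dest: sympD)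
  qed (simp add: inner_axis_1 w_def)
  then show ?thesis
    by (simp add: inner_axis_1)
next
  \<comment> \<open>With one node the polytope is a single point of mass 1 at \<open>x\<close>. The
    face is empty, and its dimension -1 is the required 0 - 1.\<close>
  case False
  then have UNIV: "(UNIV :: 'v set) = {x}"
    by auto
  obtain q where q: "q \<in> unit_sum_hyperplane" "\<forall>a\<in>mode_normals E C. a \<bullet> q > 0"
    using mode_polytope_interior_point[OF assms(2)] .
  then have "q \<in> mode_polytope E C"
    by (auto simp: mode_polytope_eq[OF assms(1,2)] less_imp_le)
  then have "\<not> aff_dim (mode_polytope E C) < 0"
    by auto
  moreover have "aff_dim (mode_polytope E C) \<le> 0"
    using aff_dim_subset[of "mode_polytope E C" unit_sum_hyperplane]
    by (simp add: mode_polytope_eq[OF assms(1,2)] aff_dim_unit_sum_hyperplane UNIV)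
  moreover have "{p \<in> mode_polytope E C. p $ x = 0} = {}"
    by (auto simp: mode_polytope_def prob_simplex_def UNIV)
  then have "aff_dim {p \<in> mode_polytope E C. p $ x = 0} = -1"
    by (simp only: aff_dim_empty_eq)
  ultimately show ?thesis
    by linarith
qed

text \<open>The point in the second claim serves to show that the face \<open>p $ x = 0\<close> is
  properly contained in this facet.\<close>

lemma aff_dim_mode_polytope_edge:
  fixes E :: "'v::finite \<Rightarrow> 'v \<Rightarrow> bool"
  assumes "simple_graph E" "independent_nodes E C" "x \<in> C" "E y x"
  shows "aff_dim {p \<in> mode_polytope E C. p $ x = p $ y} = aff_dim (mode_polytope E C) - 1"
    and "\<exists>p\<in>mode_polytope E C. p $ x = p $ y \<and> p $ x > 0"
proof -
  \<comment> \<open>The node \<open>y\<close> is outside \<open>C\<close> but may have other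
    neighbors in \<open>C\<close>; these get 3 to stay strictly above it. The other neighbors of
    \<open>x\<close> get 1 to stay strictly below \<open>x\<close>.\<close>
  define w :: "real ^ 'v" where
    "w = (\<chi> u. if u = x \<or> u = y then 2 else if u \<in> C then 3 else 1)"
  let ?a = "axis x 1 - axis y 1 :: real ^ 'v"
  have a: "?a \<in> mode_normals E C"
    using assms(3,4) by (auto simp: mode_normals_def)
  have sum: "(\<Sum>u\<in>UNIV. w $ u) > 0"
    by (intro sum_pos) (auto simp: w_def)
  have tight: "?a \<bullet> w = 0"
    by (simp add: inner_axis_1 inner_diff_left w_def)
  have slack: "\<forall>b\<in>mode_normals E C. b \<noteq> ?a \<longrightarrow> b \<bullet> w > 0"
    using assms unfolding Ball_mode_normals independent_nodes_def
    by (auto simp: inner_axis_1 inner_diff_left w_def)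
  show "aff_dim {p \<in> mode_polytope E C. p $ x = p $ y} = aff_dim (mode_polytope E C) - 1"
    using aff_dim_mode_polytope_tight[OF assms(1,2) a sum tight slack]
    by (simp add: inner_axis_1 inner_diff_left)
  obtain q c where q: "q \<in> unit_sum_hyperplane" "c > 0" "\<And>a. a \<bullet> q = c * (a \<bullet> w)"
    using normalize_weights[OF sum] by blast
  have "q $ u = c * w $ u" for u
    using q(3)[of "axis u 1"] by (simp add: inner_axis_1)
  then have "q $ x = q $ y" "q $ x > 0"
    using q(2) by (simp_all add: w_def)
  moreover have "b \<bullet> w \<ge> 0" if "b \<in> mode_normals E C" for b
    using slack tight that by (cases "b = ?a") (auto simp: less_imp_le)
  then have "q \<in> mode_polytope E C"
    using q by (auto simp: mode_polytope_eq[OF assms(1,2)])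
  ultimately show "\<exists>p\<in>mode_polytope E C. p $ x = p $ y \<and> p $ x > 0"
    by blast
qed

lemma convex_mode_polytope:
  fixes E :: "'v::finite \<Rightarrow> 'v \<Rightarrow> bool"
  assumes "simple_graph E" "independent_nodes E C"
  shows "convex (mode_polytope E C)"
proof -
  have "{p. \<forall>a\<in>mode_normals E C. a \<bullet> p \<ge> 0} = (\<Inter>a\<in>mode_normals E C. {p. a \<bullet> p \<ge> 0})"
    by auto
  then show ?thesis
    by (simp add: mode_polytope_eq[OF assms] convex_Int convex_INT convex_halfspace_ge
        affine_imp_convex affine_unit_sum_hyperplane)
qed

section \<open>Supporting hyperplanes and the three claims\<close>

lemma face_of_inner_eq_0:
  fixes P :: "'a::euclidean_space set"
  assumes "convex P" "\<forall>p\<in>P. a \<bullet> p \<ge> 0"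
  shows "{p \<in> P. a \<bullet> p = 0} face_of P"
  using face_of_Int_supporting_hyperplane_ge[of P 0 a] assms by (simp add: Int_def)

theorem proposition2:
  fixes E :: "'v::finite \<Rightarrow> 'v \<Rightarrow> bool" and C :: "'v set"
  assumes "simple_graph E" and "independent_nodes E C"
  shows "(\<forall>x. x \<notin> C \<longrightarrow>
             defines_facet (mode_polytope E C) (\<lambda>p. p $ x) (\<lambda>p. 0)) \<and>
         (\<forall>x\<in>C. defines_facet (mode_polytope E C) (\<lambda>p. p $ x) (\<lambda>p. 0)
                   \<longleftrightarrow> isolated_node E x) \<and>
         (\<forall>x\<in>C. \<forall>y. E y x \<longrightarrow>
             defines_facet (mode_polytope E C) (\<lambda>p. p $ x) (\<lambda>p. p $ y))"
proof -
  let ?P = "mode_polytope E C"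
  have convex: "convex ?P"
    using assms by (rule convex_mode_polytope)
  have nonneg: "\<forall>p\<in>?P. p $ x \<ge> 0" for x
    by (auto simp: mode_polytope_def prob_simplex_def)
  have zero_face: "{p \<in> ?P. p $ x = 0} face_of ?P" for x
    using face_of_inner_eq_0[OF convex, of "axis x 1"] nonneg by (simp add: inner_axis_1)
  have zero: "defines_facet ?P (\<lambda>p. p $ x) (\<lambda>p. 0)" if "x \<notin> C \<or> isolated_node E x" for x
    using nonneg zero_face aff_dim_mode_polytope_zero[OF assms that]
    by (simp add: defines_facet_def)
  have valid: "\<forall>p\<in>?P. p $ x \<ge> p $ y" if "x \<in> C" "E y x" for x y
    using that by (auto simp: mode_polytope_def is_mode_def)
  have edge_face: "{p \<in> ?P. p $ x = p $ y} face_of ?P" if "x \<in> C" "E y x" for x y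
    using face_of_inner_eq_0[OF convex, of "axis x 1 - axis y 1"] valid[OF that]
    by (simp add: inner_axis_1 inner_diff_left)
  have edge: "defines_facet ?P (\<lambda>p. p $ x) (\<lambda>p. p $ y)" if "x \<in> C" "E y x" for x y
    using valid edge_face aff_dim_mode_polytope_edge(1)[OF assms that] that
    by (simp add: defines_facet_def)
  have "isolated_node E x"
    if "x \<in> C" and facet: "defines_facet ?P (\<lambda>p. p $ x) (\<lambda>p. 0)" for x
  proof (rule ccontr)
    assume "\<not> isolated_node E x"
    then obtain y where "E y x"
      using assms(1) by (auto simp: isolated_node_def simple_graph_def dest: sympD)
    let ?F = "{p \<in> ?P. p $ x = 0}" and ?G = "{p \<in> ?P. p $ x = p $ y}"
    \<comment> \<open>On \<open>?F\<close> the chain \<open>0 \<le> p $ y \<le> p $ x = 0\<close>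
      collapses.\<close>
    have "?F \<subseteq> ?G"
      using nonneg[of y] valid[OF \<open>x \<in> C\<close> \<open>E y x\<close>] by force
    then have "?F face_of ?G"
      by (intro face_of_subset[OF zero_face]) auto
    moreover have "?F \<noteq> ?G"
      using aff_dim_mode_polytope_edge(2)[OF assms \<open>x \<in> C\<close> \<open>E y x\<close>] by force
    moreover have "convex ?G"
      using edge_face[OF \<open>x \<in> C\<close> \<open>E y x\<close>] by (rule face_of_imp_convex)
    \<comment> \<open>A proper face of a convex set has smaller dimension. As \<open>?G\<close>
      already lies one below \<open>?P\<close>, \<open>?F\<close> lies at least two below
      it.\<close>
    ultimately have "aff_dim ?F < aff_dim ?G"
      by (intro face_of_aff_dim_lt)
    then show False
      using facet aff_dim_mode_polytope_edge(1)[OF assms \<open>x \<in> C\<close> \<open>E y x\<close>]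
      by (simp add: defines_facet_def)
  qed
  with zero edge show ?thesis
    by blast
qed

end
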